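(* Let $w\ge 1$ be an integer and let $\mathsf{T}_{w,x}$ be the $qq$-character of the $A_1$ quiver of weight $w$ with spectral parameters $x=(x_1,\dots,x_w)$. Under the specialization $(x_1,\dots,x_w)=(x,xq_1,\dots,xq_1^{w-1})$, corresponding to the Kirillov--Reshetikhin module $\mathbf{W}^{(1)}_{w_1,x}$ of degree $w$, the $qq$-character consists of $w+1$ monomials and is given by $$\mathsf{T}[\mathbf{W}^{(1)}_{w_1,x}]=\sum_{v=0}^{w}\Bigl(\prod_{\substack{i=1,\dots,w-v\\ j=1,\dots,v}}\mathscr{S}(q_1^{1-i-j})\Bigr)\prod_{i=1}^{w-v}\mathsf{Y}_{x;i-1,0}\prod_{j=w-v+1}^{w}\mathsf{Y}_{x;j,1}^{-1}.$$
   Context: Let $q_1,q_2\in\mathbb{C}^\times$ be generic and $q=q_1q_2$. Define $\mathscr{S}(z)=\dfrac{(1-z/q_1)(1-z/q_2)}{(1-z)(1-z/(q_1q_2))}$. Let $\mathsf{Y}_x$ ($x\in\mathbb{C}^\times$) be commuting invertible formal variables; write $\mathsf{Y}_{x;j,k}=\mathsf{Y}_{xq_1^jq_2^k}$. The $qq$-character of the $A_1$ quiver of weight $w$ with generic spectral parameters $x=(x_1,\dots,x_w)$ is $$\mathsf{T}_{w,x}=\sum_{I\sqcup J=\{1,\dots,w\}}\ \prod_{i\in I,\,j\in J}\mathscr{S}\Bigl(\frac{x_i}{x_j}\Bigr)\prod_{i\in I}\mathsf{Y}_{x_i}\prod_{j\in J}\mathsf{Y}_{x_jq}^{-1}.$$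 $\mathsf{T}[\mathbf{W}^{(1)}_{w_1,x}]$ denotes the specialization of $\mathsf{T}_{w,x}$ at $(x_1,\dots,x_w)=(x,xq_1,\dots,xq_1^{w-1})$. The number of monomials is the number of distinct monomials in the $\mathsf{Y}$-variables occurring with non-zero coefficient. *)

theory Defs
  imports Complex_Main "HOL-Library.Poly_Mapping"
begin

text \<open>
  Laurent polynomials over the complex numbers in the commuting invertible variables \<open>Y\<^sub>z\<close>:
  the group algebra of the finitely supported exponent functions \<open>complex \<Rightarrow>\<^sub>0 int\<close>.
  A monomial occurs with non-zero coefficient in \<open>p\<close> iff it lies in \<open>Poly_Mapping.keys p\<close>.
  The index type also contains \<open>0\<close>; the variable \<open>Y\<^sub>0\<close> never occurs when all parameters
  are non-zero.
\<close>

type_synonym laurent = "(complex \<Rightarrow>\<^sub>0 int) \<Rightarrow>\<^sub>0 complex"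

definition Y :: "complex \<Rightarrow> laurent" where
  "Y z = Poly_Mapping.single (Poly_Mapping.single z 1) 1"

definition Yinv :: "complex \<Rightarrow> laurent" where
  "Yinv z = Poly_Mapping.single (Poly_Mapping.single z (- 1)) 1"

lemma Y_mult_Yinv: "Y z * Yinv z = 1"
  by (simp add: Y_def Yinv_def mult_single flip: single_add)

definition const :: "complex \<Rightarrow> laurent" where
  "const c = Poly_Mapping.single 0 c"

text \<open>Genericity of \<open>q\<^sub>1, q\<^sub>2\<close> is read as multiplicative independence.\<close>

definition generic :: "complex \<Rightarrow> complex \<Rightarrow> bool" where
  "generic q1 q2 \<longleftrightarrow> q1 \<noteq> 0 \<and> q2 \<noteq> 0 \<and>
     (\<forall>m n :: int. q1 powi m * q2 powi n = 1 \<longrightarrow> m = 0 \<and> n = 0)"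

definition scrS :: "complex \<Rightarrow> complex \<Rightarrow> complex \<Rightarrow> complex" where
  "scrS q1 q2 z = ((1 - z / q1) * (1 - z / q2)) / ((1 - z) * (1 - z / (q1 * q2)))"

definition Yshift :: "complex \<Rightarrow> complex \<Rightarrow> complex \<Rightarrow> int \<Rightarrow> int \<Rightarrow> laurent" where
  "Yshift q1 q2 x j k = Y (x * q1 powi j * q2 powi k)"

definition Yshift_inv :: "complex \<Rightarrow> complex \<Rightarrow> complex \<Rightarrow> int \<Rightarrow> int \<Rightarrow> laurent" where
  "Yshift_inv q1 q2 x j k = Yinv (x * q1 powi j * q2 powi k)"

text \<open>
  The spectral parameters are \<open>xs 1, \<dots>, xs w\<close>. The formula is meaningful where no
  denominator of \<open>\<S>(xs i / xs j)\<close>, \<open>i \<noteq> j\<close>, vanishes.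
\<close>

definition qq_char :: "complex \<Rightarrow> complex \<Rightarrow> nat \<Rightarrow> (nat \<Rightarrow> complex) \<Rightarrow> laurent" where
  "qq_char q1 q2 w xs =
     (\<Sum>(I, J) \<in> {(I, J). I \<union> J = {1..w} \<and> I \<inter> J = {}}.
        const (\<Prod>i\<in>I. \<Prod>j\<in>J. scrS q1 q2 (xs i / xs j)) *
        (\<Prod>i\<in>I. Y (xs i)) * (\<Prod>j\<in>J. Yinv (xs j * (q1 * q2))))"

definition KR_param :: "complex \<Rightarrow> complex \<Rightarrow> nat \<Rightarrow> complex" where
  "KR_param q1 x i = x * q1 ^ (i - 1)"

definition qq_char_KR :: "complex \<Rightarrow> complex \<Rightarrow> nat \<Rightarrow> complex \<Rightarrow> laurent" where
  "qq_char_KR q1 q2 w x = qq_char q1 q2 w (KR_param q1 x)"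

text \<open>
  The coefficients of \<open>qq_char\<close> are regular at \<open>KR_param q1 x\<close>, so the specialization is plain
  evaluation.
\<close>

lemma scrS_denominator_KR_nonzero:
  assumes "generic q1 q2" "x \<noteq> 0" "1 \<le> i" "1 \<le> j" "i \<noteq> j"
  defines "z \<equiv> KR_param q1 x i / KR_param q1 x j"
  shows "(1 - z) * (1 - z / (q1 * q2)) \<noteq> 0"
proof -
  have nz: "q1 \<noteq> 0" "q2 \<noteq> 0"
    and indep: "\<And>m n :: int. q1 powi m * q2 powi n = 1 \<Longrightarrow> m = 0 \<and> n = 0"
    using assms(1) by (auto simp: generic_def)
  have "z = q1 powi int (i - 1) / q1 powi int (j - 1)"
    using assms(2) by (simp add: z_def KR_param_def)
  also have "\<dots> = q1 powi (int (i - 1) - int (j - 1))"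
    using nz by (simp add: power_int_diff del: power_int_of_nat)
  also have "int (i - 1) - int (j - 1) = int i - int j"
    using assms(3,4) by (simp add: of_nat_diff)
  finally have z: "z = q1 powi (int i - int j)" .
  have "z \<noteq> 1"
    using indep[of "int i - int j" 0] assms(5) z by auto
  moreover have "z / (q1 * q2) = q1 powi (int i - int j - 1) * q2 powi (- 1)"
    using nz by (simp add: z power_int_diff [of q1 _ 1] power_int_minus divide_inverse del: power_int_of_nat)
  hence "z / (q1 * q2) \<noteq> 1"
    using indep[of "int i - int j - 1" "- 1"] by auto
  ultimately show ?thesis by simp
qed

end

theory Submission
  imports Defs
begin

text \<open>
  Since \<open>\<S>(q\<^sub>1) = 0\<close>, a pair \<open>(I, J)\<close> contributes nothing as soon as \<open>j + 1 \<in> I\<close> for some \<open>j \<in> J\<close>.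
  The pairs without such a \<open>j\<close> are those where \<open>I\<close> is an initial segment \<open>{1, \<dots>, w - v}\<close>, and
  reversing the order of \<open>I\<close> gives the stated coefficients. By genericity, \<open>\<S>(q\<^sub>1\<^sup>k) \<noteq> 0\<close> for \<open>k < 0\<close>,
  and the \<open>w + 1\<close> remaining monomials are told apart by their factors with positive exponent.
\<close>

lemma prod_single_one:
  fixes f :: "'a \<Rightarrow> 'b::comm_monoid_add"
  shows "(\<Prod>i\<in>A. Poly_Mapping.single (f i) (1 :: 'c::comm_semiring_1)) =
    Poly_Mapping.single (\<Sum>i\<in>A. f i) 1"
  by (induction A rule: infinite_finite_induct) (auto simp: mult_single)

text \<open>Injectivity of \<open>f\<close> puts at most one summand on each key, so no cancellation
  can occur. This reduces counting monomials to nonvanishing coefficients and distinct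
  exponents.\<close>

lemma keys_sum_single:
  assumes "finite A" "inj_on f A" "\<And>a. a \<in> A \<Longrightarrow> c a \<noteq> (0 :: 'c::comm_monoid_add)"
  shows "Poly_Mapping.keys (\<Sum>a\<in>A. Poly_Mapping.single (f a) (c a)) = f ` A"
proof -
  have "Poly_Mapping.lookup (\<Sum>a\<in>A. Poly_Mapping.single (f a) (c a)) k \<noteq> 0 \<longleftrightarrow> k \<in> f ` A" for k
  proof (cases "k \<in> f ` A")
    case True
    then obtain b where b: "b \<in> A" "k = f b" by blast
    with assms(2) have "f a = k \<longleftrightarrow> a = b" if "a \<in> A" for a
      using that by (auto simp: inj_on_def)
    then have "Poly_Mapping.lookup (\<Sum>a\<in>A. Poly_Mapping.single (f a) (c a)) k =
        (\<Sum>a\<in>A. if a = b then c a else 0)"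
      by (auto simp: lookup_sum lookup_single when_def intro!: sum.cong)
    with assms b True show ?thesis by (simp add: sum.delta')
  next
    case False
    then show ?thesis
      by (auto simp: lookup_sum lookup_single when_def intro!: sum.neutral)
  qed
  then show ?thesis by (auto simp: in_keys_iff)
qed

lemma generic_nonzero:
  assumes "generic q1 q2"
  shows "q1 \<noteq> 0" "q2 \<noteq> 0"
  using assms by (auto simp: generic_def)

text \<open>Dividing one side by the other gives a relation between \<open>q1\<close> and
  \<open>q2\<close>, which genericity makes trivial. Comparisons of spectral parameters thereby
  become comparisons of integer exponents.\<close>

lemma generic_powi_eq_iff:
  assumes "generic q1 q2"
  shows "q1 powi a * q2 powi b = q1 powi c * q2 powi d \<longleftrightarrow> a = c \<and> b = d"
proof
  note nz = generic_nonzero[OF assms]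
  assume "q1 powi a * q2 powi b = q1 powi c * q2 powi d"
  with nz have "q1 powi (a - c) * q2 powi (b - d) = 1"
    by (simp add: power_int_diff)
  with assms have "a - c = 0 \<and> b - d = 0"
    unfolding generic_def by blast
  then show "a = c \<and> b = d" by simp
qed simp

lemma scrS_q1: "q1 \<noteq> 0 \<Longrightarrow> scrS q1 q2 q1 = 0"
  by (simp add: scrS_def)

lemma scrS_powi_nonzero:
  assumes gen: "generic q1 q2" and "k < 0"
  shows "scrS q1 q2 (q1 powi k) \<noteq> 0"
proof -
  note nz = generic_nonzero[OF gen]
  \<comment> \<open>These are the two zeros and the two poles of \<open>scrS\<close>. The poles must
    be excluded too, since division by zero yields 0.\<close>
  have "q1 powi k \<noteq> q1" "q1 powi k \<noteq> q2" "q1 powi k \<noteq> 1" "q1 powi k \<noteq> q1 * q2"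
    using generic_powi_eq_iff[OF gen, of k 0 1 0] generic_powi_eq_iff[OF gen, of k 0 0 1]
      generic_powi_eq_iff[OF gen, of k 0 0 0] generic_powi_eq_iff[OF gen, of k 0 1 1] \<open>k < 0\<close>
    by auto
  with nz show ?thesis by (simp add: scrS_def)
qed

text \<open>Integer exponents may be subtracted freely in ratios of parameters;
  \<open>i \<ge> 1\<close> keeps clear of the truncated \<open>0 - 1 = 0\<close>.\<close>

lemma KR_param_powi: "i \<ge> 1 \<Longrightarrow> KR_param q1 x i = x * q1 powi (int i - 1)"
  by (metis KR_param_def of_nat_1 of_nat_diff power_int_of_nat)

lemma KR_param_divide:
  assumes "q1 \<noteq> 0" "x \<noteq> 0" "i \<ge> 1" "j \<ge> 1"
  shows "KR_param q1 x i / KR_param q1 x j = q1 powi (int i - int j)"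
  using assms by (simp add: KR_param_powi flip: power_int_diff)

lemma initial_segment_split:
  fixes w :: nat
  assumes un: "I \<union> J = {1..w}" and disj: "I \<inter> J = {}"
    and no_step: "\<And>j. j \<in> J \<Longrightarrow> Suc j \<notin> I"
  obtains v where "v \<le> w" "I = {1..w - v}" "J = {w - v + 1..w}"
proof -
  \<comment> \<open>Inserting 0 covers the empty \<open>I\<close>, where \<open>m = 0\<close> and
    hence \<open>v = w\<close>.\<close>
  define m where "m = Max (insert 0 I)"
  have fin: "finite I" using un by (metis finite_Un finite_atLeastAtMost)
  have "m \<in> insert 0 I" unfolding m_def using fin by (intro Max_in) auto
  have le: "i \<le> m" if "i \<in> I" for i using that fin by (simp add: m_def)
  have "m \<le> w" using \<open>m \<in> insert 0 I\<close> un by fastforce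
  have "i \<in> I" if "i \<le> m" "1 \<le> i" for i
    using that
  \<comment> \<open>Downward induction from \<open>m\<close>: by \<open>no_step\<close>, membership
    of \<open>Suc n\<close> in \<open>I\<close> keeps \<open>n\<close> out of
    \<open>J\<close>.\<close>
  proof (induction i rule: inc_induct)
    case base
    then show ?case using \<open>m \<in> insert 0 I\<close> by simp
  next
    case (step n)
    then have "Suc n \<in> I" by simp
    then have "n \<notin> J" using no_step by blast
    moreover have "n \<in> {1..w}" using step \<open>m \<le> w\<close> by simp
    ultimately show ?case using un by blast
  qed
  moreover have "I \<subseteq> {1..m}" using le un by fastforce
  ultimately have I: "I = {1..m}" by fastforce
  have "J = {1..w} - I" using un disj by blast
  also have "\<dots> = {m + 1..w}" by (auto simp: I)
  finally have "J = {m + 1..w}" .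
  with I \<open>m \<le> w\<close> show ?thesis by (intro that[of "w - m"]) auto
qed

lemma sum_splits_eq_sum_initial_segments:
  fixes f :: "nat set \<Rightarrow> nat set \<Rightarrow> 'a::comm_monoid_add"
  assumes zero: "\<And>I J j. I \<union> J = {1..w} \<Longrightarrow> j \<in> J \<Longrightarrow> Suc j \<in> I \<Longrightarrow> f I J = 0"
  shows "(\<Sum>(I, J) \<in> {(I, J). I \<union> J = {1..w} \<and> I \<inter> J = {}}. f I J) =
    (\<Sum>v = 0..w. f {1..w - v} {w - v + 1..w})"
proof -
  let ?S = "{(I, J). I \<union> J = {1..w} \<and> I \<inter> J = {}}"
  let ?g = "\<lambda>v. ({1..w - v}, {w - v + 1..w})"
  have "?S \<subseteq> Pow {1..w} \<times> Pow {1..w}" by auto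
  then have fin: "finite ?S" by (rule finite_subset) simp
  have sub: "?g ` {0..w} \<subseteq> ?S" by auto
  have inj: "inj_on ?g {0..w}"
  proof (rule inj_onI)
    fix u v assume "u \<in> {0..w}" "v \<in> {0..w}" "?g u = ?g v"
    \<comment> \<open>The size of the first component determines the index, because both indices are
      at most \<open>w\<close>.\<close>
    then have "card {1..w - u} = card {1..w - v}" by (metis fst_conv)
    with \<open>u \<in> {0..w}\<close> \<open>v \<in> {0..w}\<close> show "u = v" by auto
  qed
  have "f I J = 0" if "(I, J) \<in> ?S - ?g ` {0..w}" for I J
  proof (rule ccontr)
    assume "f I J \<noteq> 0"
    from that have IJ: "I \<union> J = {1..w}" "I \<inter> J = {}" by auto
    from IJ(1) have "Suc j \<notin> I" if "j \<in> J" for j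
      using zero[of I J j] that \<open>f I J \<noteq> 0\<close> by blast
    with IJ obtain v where "v \<le> w" "I = {1..w - v}" "J = {w - v + 1..w}"
      by (rule initial_segment_split)
    with that show False by auto
  qed
  then have "(\<Sum>(I, J) \<in> ?S. f I J) = (\<Sum>(I, J) \<in> ?g ` {0..w}. f I J)"
    by (intro sum.mono_neutral_right[OF fin sub]) auto
  also have "\<dots> = (\<Sum>v = 0..w. f {1..w - v} {w - v + 1..w})"
    by (subst sum.reindex[OF inj]) simp
  finally show ?thesis .
qed

text \<open>The ratio of parameters is \<open>q1 powi (i - j)\<close>. Replacing \<open>i\<close> by
  \<open>w - v + 1 - i\<close> and \<open>j\<close> by \<open>w - v + j\<close> turns the exponent
  into \<open>1 - i - j\<close>.\<close>

lemma prod_KR_initial_segment: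
  assumes "q1 \<noteq> 0" "x \<noteq> 0" "v \<le> w"
  shows "(\<Prod>i\<in>{1..w - v}. \<Prod>j\<in>{w - v + 1..w}. scrS q1 q2 (KR_param q1 x i / KR_param q1 x j)) =
    (\<Prod>i = 1..w - v. \<Prod>j = 1..v. scrS q1 q2 (q1 powi (1 - int i - int j)))"
proof -
  have "(\<Prod>i\<in>{1..w - v}. \<Prod>j\<in>{w - v + 1..w}. scrS q1 q2 (KR_param q1 x i / KR_param q1 x j)) =
      (\<Prod>i = 1..w - v. \<Prod>j = w - v + 1..w. scrS q1 q2 (q1 powi (int i - int j)))"
    using assms by (intro prod.cong refl) (simp add: KR_param_divide)
  also have "\<dots> = (\<Prod>i = 1..w - v. \<Prod>j = w - v + 1..w. scrS q1 q2 (q1 powi (int (w - v + 1 - i) - int j)))"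
    by (rule prod.reindex_bij_witness[of _ "\<lambda>i. w - v + 1 - i" "\<lambda>i. w - v + 1 - i"]) auto
  also have "\<dots> = (\<Prod>i = 1..w - v. \<Prod>j = 1..v. scrS q1 q2 (q1 powi (1 - int i - int j)))"
  proof (rule prod.cong[OF refl])
    fix i assume "i \<in> {1..w - v}"
    with assms(3) show "(\<Prod>j = w - v + 1..w. scrS q1 q2 (q1 powi (int (w - v + 1 - i) - int j))) =
        (\<Prod>j = 1..v. scrS q1 q2 (q1 powi (1 - int i - int j)))"
      by (intro prod.reindex_bij_witness[of _ "\<lambda>j. w - v + j" "\<lambda>j. j - (w - v)"])
        (auto simp: of_nat_diff intro!: arg_cong[of _ _ "scrS q1 q2"] arg_cong[of _ _ "power_int q1"])
  qed
  finally show ?thesis .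
qed

lemma qq_char_KR_eq:
  assumes gen: "generic q1 q2" and x: "x \<noteq> 0"
  shows "qq_char_KR q1 q2 w x =
    (\<Sum>v = 0..w.
       const (\<Prod>i = 1..w - v. \<Prod>j = 1..v. scrS q1 q2 (q1 powi (1 - int i - int j))) *
       (\<Prod>i = 1..w - v. Yshift q1 q2 x (int i - 1) 0) *
       (\<Prod>j = w - v + 1..w. Yshift_inv q1 q2 x (int j) 1))"
proof -
  note nz = generic_nonzero[OF gen]
  let ?xs = "KR_param q1 x"
  let ?c = "\<lambda>I J. \<Prod>i\<in>I. \<Prod>j\<in>J. scrS q1 q2 (?xs i / ?xs j)"
  have "?c I J = 0" if un: "I \<union> J = {1..w}" and j: "j \<in> J" "Suc j \<in> I" for I J j
  proof -
    \<comment> \<open>Finiteness matters: a product over an infinite set is 1 by convention, so a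
      zero factor would not make it vanish.\<close>
    from un have fin: "finite I" "finite J" by (metis finite_Un finite_atLeastAtMost)+
    from un j have "j \<ge> 1" by fastforce
    then have "?xs (Suc j) / ?xs j = q1"
      using KR_param_divide[OF nz(1) x, of "Suc j" j] by simp
    then have "scrS q1 q2 (?xs (Suc j) / ?xs j) = 0"
      using nz by (simp add: scrS_q1)
    with fin j show ?thesis by (auto intro!: prod_zero)
  qed
  then have "qq_char_KR q1 q2 w x =
      (\<Sum>v = 0..w. const (?c {1..w - v} {w - v + 1..w}) *
        (\<Prod>i\<in>{1..w - v}. Y (?xs i)) * (\<Prod>j\<in>{w - v + 1..w}. Yinv (?xs j * (q1 * q2))))"
    unfolding qq_char_KR_def qq_char_def
    by (intro sum_splits_eq_sum_initial_segments) (simp add: const_def)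
  also have "\<dots> = (\<Sum>v = 0..w.
       const (\<Prod>i = 1..w - v. \<Prod>j = 1..v. scrS q1 q2 (q1 powi (1 - int i - int j))) *
       (\<Prod>i = 1..w - v. Yshift q1 q2 x (int i - 1) 0) *
       (\<Prod>j = w - v + 1..w. Yshift_inv q1 q2 x (int j) 1))"
  proof (intro sum.cong refl arg_cong2[of _ _ _ _ "(*)"] prod.cong)
    fix v assume "v \<in> {0..w}"
    then show "const (?c {1..w - v} {w - v + 1..w}) =
        const (\<Prod>i = 1..w - v. \<Prod>j = 1..v. scrS q1 q2 (q1 powi (1 - int i - int j)))"
      using nz x by (subst prod_KR_initial_segment) auto
  next
    fix v i assume "i \<in> {1..w - v}"
    then show "Y (?xs i) = Yshift q1 q2 x (int i - 1) 0"
      by (simp add: Yshift_def KR_param_powi)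
  next
    fix v j assume "j \<in> {w - v + 1..w}"
    \<comment> \<open>In the shift by \<open>q1 * q2\<close>, the factor \<open>q1\<close> raises
      the exponent \<open>j - 1\<close> to \<open>j\<close>, and \<open>q2\<close> gives the second
      index 1.\<close>
    then have "?xs j * q1 = x * q1 powi int j"
      using nz by (simp add: KR_param_powi power_int_diff del: power_int_of_nat)
    then show "Yinv (?xs j * (q1 * q2)) = Yshift_inv q1 q2 x (int j) 1"
      by (simp add: Yshift_inv_def mult.assoc[symmetric] del: power_int_of_nat)
  qed
  finally show ?thesis .
qed

text \<open>The exponent vector of the \<open>v\<close>-th monomial. The factors
  \<open>q2 powi 0\<close> and \<open>q2 powi 1\<close> are kept to match the unfolded
  \<open>Yshift\<close> and \<open>Yshift_inv\<close>.\<close>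

definition KR_exponent :: "complex \<Rightarrow> complex \<Rightarrow> nat \<Rightarrow> complex \<Rightarrow> nat \<Rightarrow> (complex \<Rightarrow>\<^sub>0 int)" where
  "KR_exponent q1 q2 w x v =
     (\<Sum>i = 1..w - v. Poly_Mapping.single (x * q1 powi (int i - 1) * q2 powi 0) 1) +
     (\<Sum>j = w - v + 1..w. Poly_Mapping.single (x * q1 powi int j * q2 powi 1) (- 1))"

lemma KR_monomial_eq_single:
  "const c * (\<Prod>i = 1..w - v. Yshift q1 q2 x (int i - 1) 0) *
    (\<Prod>j = w - v + 1..w. Yshift_inv q1 q2 x (int j) 1) =
   Poly_Mapping.single (KR_exponent q1 q2 w x v) c"
  unfolding const_def Yshift_def Yshift_inv_def Y_def Yinv_def KR_exponent_def prod_single_one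
  by (simp add: mult_single)

text \<open>The inverse variables all carry one factor \<open>q2\<close> and the probed variable
  carries none, so by genericity only the positive part of the monomial contributes.\<close>

lemma lookup_KR_exponent:
  assumes gen: "generic q1 q2" and x: "x \<noteq> 0" and "n \<ge> 1"
  shows "Poly_Mapping.lookup (KR_exponent q1 q2 w x v) (x * q1 powi (int n - 1)) =
    (if n \<le> w - v then 1 else 0)"
proof -
  have pos: "x * q1 powi (int i - 1) * q2 powi 0 = x * q1 powi (int n - 1) \<longleftrightarrow> i = n" for i
    using x generic_powi_eq_iff[OF gen, of "int i - 1" 0 "int n - 1" 0] by auto
  have neg: "x * q1 powi int j * q2 powi 1 \<noteq> x * q1 powi (int n - 1)" for j
    using x generic_powi_eq_iff[OF gen, of "int j" 1 "int n - 1" 0] by auto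
  show ?thesis
    unfolding KR_exponent_def lookup_add lookup_sum lookup_single when_def pos
    using \<open>n \<ge> 1\<close> neg by (simp only: if_False sum.delta sum.neutral_const) simp
qed

lemma inj_on_KR_exponent:
  assumes "generic q1 q2" "x \<noteq> 0"
  shows "inj_on (KR_exponent q1 q2 w x) {0..w}"
proof (rule linorder_inj_onI')
  fix u v assume "u \<in> {0..w}" "v \<in> {0..w}" "u < v"
  \<comment> \<open>The variable with \<open>n = w - u\<close> is the last positive factor of
    monomial \<open>u\<close> and is absent from the positive part of monomial
    \<open>v\<close>.\<close>
  then have "w - u \<ge> 1" "\<not> w - u \<le> w - v" by auto
  then show "KR_exponent q1 q2 w x u \<noteq> KR_exponent q1 q2 w x v"
    using lookup_KR_exponent[OF assms, of "w - u" w u] lookup_KR_exponent[OF assms, of "w - u" w v]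
    by auto
qed

theorem theorem3p4:
  fixes q1 q2 x :: complex and w :: nat
  assumes "generic q1 q2" and "x \<noteq> 0" and "w \<ge> 1"
  shows "card (Poly_Mapping.keys (qq_char_KR q1 q2 w x)) = w + 1 \<and>
    qq_char_KR q1 q2 w x =
      (\<Sum>v = 0..w.
         const (\<Prod>i = 1..w - v. \<Prod>j = 1..v. scrS q1 q2 (q1 powi (1 - int i - int j))) *
         (\<Prod>i = 1..w - v. Yshift q1 q2 x (int i - 1) 0) *
         (\<Prod>j = w - v + 1..w. Yshift_inv q1 q2 x (int j) 1))"
proof
  show formula: "qq_char_KR q1 q2 w x =
      (\<Sum>v = 0..w.
         const (\<Prod>i = 1..w - v. \<Prod>j = 1..v. scrS q1 q2 (q1 powi (1 - int i - int j))) *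
         (\<Prod>i = 1..w - v. Yshift q1 q2 x (int i - 1) 0) *
         (\<Prod>j = w - v + 1..w. Yshift_inv q1 q2 x (int j) 1))"
    using assms by (intro qq_char_KR_eq)
  \<comment> \<open>For \<open>i, j \<ge> 1\<close> the exponent \<open>1 - i - j\<close> is
    negative, so every factor of every coefficient is nonzero; for \<open>v = 0\<close> and
    \<open>v = w\<close> the coefficient is an empty product.\<close>
  have "Poly_Mapping.keys (qq_char_KR q1 q2 w x) = KR_exponent q1 q2 w x ` {0..w}"
    unfolding formula KR_monomial_eq_single
    using assms
    by (intro keys_sum_single inj_on_KR_exponent) (auto simp: scrS_powi_nonzero)
  then show "card (Poly_Mapping.keys (qq_char_KR q1 q2 w x)) = w + 1"
    using assms by (simp add: card_image inj_on_KR_exponent)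
qed

end
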